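(* For every worm $A$ and every ordinal $\xi$, $o_\xi(A)=o_\xi(h_\xi(A))=\check o_\xi(h_\xi(A))$.
   Context: Formulas of the Reflection Calculus $\mathsf{RC}$ are given by $\phi ::= \top \mid \phi\wedge\psi \mid \alpha\phi$ with $\alpha$ any ordinal ($\alpha\phi$ is also written $\langle\alpha\rangle\phi$). We write $\phi\vdash\psi$ if this sequent is derivable from: $\phi\vdash\phi$; $\phi\vdash\top$; $\phi\wedge\psi\vdash\phi$; $\phi\wedge\psi\vdash\psi$; $\alpha\alpha\phi\vdash\alpha\phi$; $\beta\phi\vdash\alpha\phi$ and $\beta\phi\wedge\alpha\psi\vdash\beta(\phi\wedge\alpha\psi)$ for $\alpha<\beta$; with the rules: from $\phi\vdash\psi$ and $\psi\vdash\chi$ infer $\phi\vdash\chi$; from $\phi\vdash\psi$ and $\phi\vdash\chi$ infer $\phi\vdash\psi\wedge\chi$; from $\phi\vdash\psi$ infer $\alpha\phi\vdash\alpha\psi$. (The polymodal provability logic $\mathsf{GLP}$ is conservative over $\mathsf{RC}$, so equivalently $\mathsf{GLP}\vdash\phi\to\psi$.) Worms: $\mathbb W$ is the least class containing $\top$ and closed under $A\mapsto\langle\alpha\rangle A$ for each ordinal $\alpha$; $\mathbb W_\xi$ is the class of worms all of whose modalities are $\geq\xi$. $A<_\xi B$ iff $B\vdash\langle\xi\rangle A$; this relation is well-founded on $\mathbb W$. Define $o_\xi(A):=\sup\{o_\xi(B)+1: B\in\mathbb W,\ B<_\xi A\}$ for $A\in\mathbb W$, and $\check o_\xi(A):=\sup\{\check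 o_\xi(B)+1: B\in\mathbb W_\xi,\ B<_\xi A\}$ for $A\in\mathbb W_\xi$ (with $\sup\varnothing=0$). The $\xi$-head: $h_\xi(\top)=\top$, $h_\xi(\zeta A)=\zeta h_\xi(A)$ if $\zeta\ge\xi$, and $h_\xi(\zeta A)=\top$ if $\zeta<\xi$. *)

theory Defs
  imports Main "HOL-Library.Infinite_Typeclass"
begin

unbundle cardinal_syntax

section \<open>Ordinals\<close>

text \<open>
  An element of \<open>'u ordinal\<close> is the order type of a well-order whose field is a subset of the
  type \<open>'u\<close>; for infinite \<open>'u\<close> these are exactly the ordinals below the successor cardinal of
  the cardinality of \<open>'u\<close>.  HOL has no type of all ordinals; the type \<open>'u\<close> is the
  (arbitrary) bound on the size of the ordinals under consideration.
\<close>

quotient_type 'u ordinal = "'u rel" / partial: "\<lambda>r s. r =o s"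
proof (rule part_equivpI)
  show "\<exists>r :: 'u rel. r =o r"
    by (rule exI[of _ "{}"]) (simp add: ordIso_reflexive)
  show "symp (\<lambda>r s :: 'u rel. r =o s)"
    by (auto intro: sympI ordIso_symmetric)
  show "transp (\<lambda>r s :: 'u rel. r =o s)"
    by (auto intro: transpI ordIso_transitive)
qed

lemma ordIso_well_orderD:
  assumes "r =o s"
  shows "Well_order r" "Well_order s"
  using assms by (auto simp: ordIso_def)

instantiation ordinal :: (type) linorder
begin

lift_definition less_eq_ordinal :: "'u ordinal \<Rightarrow> 'u ordinal \<Rightarrow> bool" is "\<lambda>r s. r \<le>o s"
  by (meson ordIso_ordLeq_trans ordIso_symmetric ordLeq_ordIso_trans)

lift_definition less_ordinal :: "'u ordinal \<Rightarrow> 'u ordinal \<Rightarrow> bool" is "\<lambda>r s. r <o s"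
  by (meson ordIso_ordLess_trans ordIso_symmetric ordLess_ordIso_trans)

instance
proof
  fix x y z :: "'u ordinal"
  show "x < y \<longleftrightarrow> x \<le> y \<and> \<not> y \<le> x"
    by transfer (meson not_ordLeq_iff_ordLess ordIso_well_orderD(1) ordLess_imp_ordLeq)
  show "x \<le> x"
    by transfer (meson ordIso_well_orderD(1) ordLeq_reflexive)
  show "x \<le> y \<Longrightarrow> y \<le> z \<Longrightarrow> x \<le> z"
    by transfer (meson ordLeq_transitive)
  show "x \<le> y \<Longrightarrow> y \<le> x \<Longrightarrow> x = y"
    by transfer (meson ordIso_iff_ordLeq)
  show "x \<le> y \<or> y \<le> x"
    by transfer (meson ordIso_well_orderD(1) ordLeq_total)
qed

end

instance ordinal :: (type) wellorder
proof
  fix P :: "'u ordinal \<Rightarrow> bool" and a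
  assume step: "\<And>x. (\<And>y. y < x \<Longrightarrow> P y) \<Longrightarrow> P x"
  have "wf (inv_image ordLess (rep_ordinal :: 'u ordinal \<Rightarrow> _))"
    by (intro wf_inv_image wf_ordLess)
  moreover have "inv_image ordLess rep_ordinal = {(x, y :: 'u ordinal). x < y}"
    by (auto simp: less_ordinal.rep_eq)
  ultimately have "wf {(x, y :: 'u ordinal). x < y}"
    by simp
  then show "P a"
    by (induction a rule: wf_induct_rule) (auto intro: step)
qed

instantiation ordinal :: (type) conditionally_complete_linorder
begin

definition sup_ordinal :: "'u ordinal \<Rightarrow> 'u ordinal \<Rightarrow> 'u ordinal" where
  "sup_ordinal = max"
definition inf_ordinal :: "'u ordinal \<Rightarrow> 'u ordinal \<Rightarrow> 'u ordinal" where
  "inf_ordinal = min"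
definition Sup_ordinal :: "'u ordinal set \<Rightarrow> 'u ordinal" where
  "Sup_ordinal S = (LEAST \<beta>. \<forall>\<alpha>\<in>S. \<alpha> \<le> \<beta>)"
definition Inf_ordinal :: "'u ordinal set \<Rightarrow> 'u ordinal" where
  "Inf_ordinal S = (LEAST \<alpha>. \<alpha> \<in> S)"

instance
proof
  fix x z :: "'u ordinal" and X :: "'u ordinal set"
  show "Inf X \<le> x" if "x \<in> X"
    using that by (simp add: Inf_ordinal_def Least_le)
  show "z \<le> Inf X" if "X \<noteq> {}" "\<And>x. x \<in> X \<Longrightarrow> z \<le> x"
    using that unfolding Inf_ordinal_def by (metis LeastI ex_in_conv)
  show "x \<le> Sup X" if "x \<in> X" "bdd_above X"
  proof -
    obtain b where "\<forall>\<alpha>\<in>X. \<alpha> \<le> b"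
      using \<open>bdd_above X\<close> by (auto simp: bdd_above_def)
    then have "\<forall>\<alpha>\<in>X. \<alpha> \<le> Sup X"
      unfolding Sup_ordinal_def by (rule LeastI)
    with \<open>x \<in> X\<close> show ?thesis by blast
  qed
  show "Sup X \<le> z" if "\<And>x. x \<in> X \<Longrightarrow> x \<le> z"
    unfolding Sup_ordinal_def using that by (auto intro: Least_le)
qed (auto simp: sup_ordinal_def inf_ordinal_def)

end

definition osucc :: "'u ordinal \<Rightarrow> 'u ordinal" where
  "osucc \<alpha> = (LEAST \<beta>. \<alpha> < \<beta>)"


section \<open>The Reflection Calculus\<close>

datatype (modalities: 'm) rc = Top | Conj "'m rc" "'m rc" | Dia 'm "'m rc"

type_synonym 'u formula = "'u ordinal rc"

inductive rc_derives :: "'u formula \<Rightarrow> 'u formula \<Rightarrow> bool"  (infix "\<turnstile>" 50) where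
  refl: "\<phi> \<turnstile> \<phi>"
| top: "\<phi> \<turnstile> Top"
| conjE1: "Conj \<phi> \<psi> \<turnstile> \<phi>"
| conjE2: "Conj \<phi> \<psi> \<turnstile> \<psi>"
| trans4: "Dia \<alpha> (Dia \<alpha> \<phi>) \<turnstile> Dia \<alpha> \<phi>"
| mono: "\<alpha> < \<beta> \<Longrightarrow> Dia \<beta> \<phi> \<turnstile> Dia \<alpha> \<phi>"
| polytrans: "\<alpha> < \<beta> \<Longrightarrow> Conj (Dia \<beta> \<phi>) (Dia \<alpha> \<psi>) \<turnstile> Dia \<beta> (Conj \<phi> (Dia \<alpha> \<psi>))"
| cut: "\<phi> \<turnstile> \<psi> \<Longrightarrow> \<psi> \<turnstile> \<chi> \<Longrightarrow> \<phi> \<turnstile> \<chi>"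
| conjI: "\<phi> \<turnstile> \<psi> \<Longrightarrow> \<phi> \<turnstile> \<chi> \<Longrightarrow> \<phi> \<turnstile> Conj \<psi> \<chi>"
| nec: "\<phi> \<turnstile> \<psi> \<Longrightarrow> Dia \<alpha> \<phi> \<turnstile> Dia \<alpha> \<psi>"


section \<open>Worms\<close>

inductive_set worms :: "'u formula set" where
  Top: "Top \<in> worms"
| Dia: "A \<in> worms \<Longrightarrow> Dia \<alpha> A \<in> worms"

definition worms_ge :: "'u ordinal \<Rightarrow> 'u formula set" where
  "worms_ge \<xi> = {A \<in> worms. \<forall>\<zeta>\<in>modalities A. \<xi> \<le> \<zeta>}"

definition worm_less :: "'u ordinal \<Rightarrow> 'u formula \<Rightarrow> 'u formula \<Rightarrow> bool" where
  "worm_less \<xi> A B \<longleftrightarrow> B \<turnstile> Dia \<xi> A"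

primrec (nonexhaustive) head :: "'u ordinal \<Rightarrow> 'u formula \<Rightarrow> 'u formula" where
  "head \<xi> Top = Top"
| "head \<xi> (Dia \<zeta> A) = (if \<xi> \<le> \<zeta> then Dia \<zeta> (head \<xi> A) else Top)"

text \<open>
  The order types \<open>o_rank\<close> and \<open>o_rank_ge\<close> are the functions usually written
  $o_\xi$ and $\check o_\xi$.  Both are defined by recursion along \<open>worm_less \<xi>\<close>, restricted to
  the domain of the function.  These relations are well-founded (this is not proved here); under
  that hypothesis \<open>o_rank_eq\<close> and \<open>o_rank_ge_eq\<close> below are the recursion equations.
\<close>

definition o_rank :: "'u ordinal \<Rightarrow> 'u formula \<Rightarrow> 'u ordinal" where
  "o_rank \<xi> = wfrec {(B, A). B \<in> worms \<and> A \<in> worms \<and> worm_less \<xi> B A}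
     (\<lambda>f A. SUP B \<in> {B \<in> worms. worm_less \<xi> B A}. osucc (f B))"

definition o_rank_ge :: "'u ordinal \<Rightarrow> 'u formula \<Rightarrow> 'u ordinal" where
  "o_rank_ge \<xi> = wfrec {(B, A). B \<in> worms_ge \<xi> \<and> A \<in> worms_ge \<xi> \<and> worm_less \<xi> B A}
     (\<lambda>f A. SUP B \<in> {B \<in> worms_ge \<xi>. worm_less \<xi> B A}. osucc (f B))"

lemma o_rank_eq:
  assumes "wf {(B, A). B \<in> worms \<and> A \<in> worms \<and> worm_less \<xi> B A}" "A \<in> worms"
  shows "o_rank \<xi> A = (SUP B \<in> {B \<in> worms. worm_less \<xi> B A}. osucc (o_rank \<xi> B))"
  unfolding o_rank_def
  by (subst wfrec[OF assms(1)], intro arg_cong[of _ _ Sup] image_cong refl)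
     (use assms(2) in \<open>auto simp: cut_apply\<close>)

lemma o_rank_ge_eq:
  assumes "wf {(B, A). B \<in> worms_ge \<xi> \<and> A \<in> worms_ge \<xi> \<and> worm_less \<xi> B A}" "A \<in> worms_ge \<xi>"
  shows "o_rank_ge \<xi> A = (SUP B \<in> {B \<in> worms_ge \<xi>. worm_less \<xi> B A}. osucc (o_rank_ge \<xi> B))"
  unfolding o_rank_ge_def
  by (subst wfrec[OF assms(1)], intro arg_cong[of _ _ Sup] image_cong refl)
     (use assms(2) in \<open>auto simp: cut_apply\<close>)

subsection \<open>Existence of the successors and suprema\<close>

text \<open>
  For infinite \<open>'u\<close>, every set of at most \<open>|UNIV :: 'u set|\<close> many ordinals has a strict upper
  bound, and only that many worms lie below a given worm.  Hence every successor and supremum used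
  above is the genuine one.
\<close>

definition ord_rel :: "'u ordinal set \<Rightarrow> 'u ordinal rel" where
  "ord_rel D = {(x, y). x \<in> D \<and> y \<in> D \<and> x \<le> y}"

lemma Field_ord_rel [simp]: "Field (ord_rel D) = D"
  by (auto simp: ord_rel_def Field_def)

lemma Well_order_ord_rel: "Well_order (ord_rel D)"
proof -
  have "wf {(x, y :: 'u ordinal). x < y}"
    by (rule wf)
  then have "wf (ord_rel D - Id)"
    by (rule wf_subset) (auto simp: ord_rel_def)
  moreover have "Linear_order (ord_rel D)"
    unfolding order_on_defs Field_ord_rel
    by (auto simp: ord_rel_def refl_on_def trans_def antisym_def total_on_def)
  ultimately show ?thesis
    unfolding well_order_on_def by blast
qed

lemma Restr_underS_ord_rel:
  assumes "\<beta> \<in> D" "\<And>\<gamma>. \<gamma> < \<beta> \<Longrightarrow> \<gamma> \<in> D"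
  shows "Restr (ord_rel D) (underS (ord_rel D) \<beta>) = ord_rel {..<\<beta>}"
  using assms by (auto simp: ord_rel_def underS_def)

lemma rep_ordinal_iso: "rep_ordinal \<beta> =o rep_ordinal \<beta>"
  using Quotient_rep_reflp[OF Quotient_ordinal] .

lemma abs_ordinal_iso: "Well_order r \<Longrightarrow> rep_ordinal (abs_ordinal r) =o r"
  using Quotient_rep_abs[OF Quotient_ordinal, of r] ordIso_reflexive by blast

lemma ordinal_segment: "rep_ordinal \<beta> =o ord_rel {..<\<beta>}"
proof (induction \<beta> rule: less_induct)
  case (less \<beta>)
  let ?r = "rep_ordinal \<beta>" and ?s = "ord_rel {..<\<beta>}"
  have wr: "Well_order ?r"
    using rep_ordinal_iso ordIso_well_orderD by blast
  have seg: "Restr ?s (underS ?s \<gamma>) = ord_rel {..<\<gamma>}" if "\<gamma> < \<beta>" for \<gamma>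
    using that by (intro Restr_underS_ord_rel) auto
  have lt: "ord_rel {..<\<gamma>} <o ?s" if "\<gamma> < \<beta>" for \<gamma>
  proof -
    have "Field ?s \<noteq> {}"
      using that by (metis Field_ord_rel empty_iff lessThan_iff)
    then show ?thesis
      using underS_Restr_ordLess[of ?s \<gamma>, OF Well_order_ord_rel] seg[OF that] by simp
  qed
  have "?r \<le>o ?s"
    unfolding ordLeq_iff_ordLess_Restr[OF wr Well_order_ord_rel]
  proof
    fix a assume a: "a \<in> Field ?r"
    let ?t = "Restr ?r (underS ?r a)"
    have t: "?t <o ?r" using underS_Restr_ordLess[OF wr] a by blast
    have i: "rep_ordinal (abs_ordinal ?t) =o ?t"
      by (intro abs_ordinal_iso Well_order_Restr wr)
    then have "abs_ordinal ?t < \<beta>"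
      using t unfolding less_ordinal.rep_eq by (rule ordIso_ordLess_trans)
    then show "?t <o ?s"
      using less.IH i lt by (meson ordIso_ordLess_trans ordIso_symmetric)
  qed
  moreover have "?s \<le>o ?r"
    unfolding ordLeq_iff_ordLess_Restr[OF Well_order_ord_rel wr]
  proof
    fix \<gamma> assume "\<gamma> \<in> Field ?s"
    then have g: "\<gamma> < \<beta>" by simp
    then have "rep_ordinal \<gamma> <o ?r" by (simp add: less_ordinal.rep_eq)
    then show "Restr ?s (underS ?s \<gamma>) <o ?r"
      using less.IH[OF g] seg[OF g] by (metis ordIso_ordLess_trans ordIso_symmetric)
  qed
  ultimately show ?case by (simp add: ordIso_iff_ordLeq)
qed

lemma card_lessThan_ordinal: "|{..<\<beta> :: 'u ordinal}| \<le>o |UNIV :: 'u set|"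
proof -
  obtain f where "bij_betw f (Field (rep_ordinal \<beta>)) {..<\<beta>}"
    using ordinal_segment[of \<beta>] unfolding ordIso_def by (auto dest: iso_Field simp: iso_def)
  then have "|{..<\<beta>}| =o |Field (rep_ordinal \<beta>)|"
    using card_of_ordIso ordIso_symmetric by blast
  also have "|Field (rep_ordinal \<beta>)| \<le>o |UNIV :: 'u set|"
    by (rule card_of_mono1) simp
  finally show ?thesis .
qed

lemma infinite_type: "infinite (UNIV :: 'u::infinite set)"
  by (rule infinite_UNIV)

lemma small_Un:
  assumes "|A| \<le>o |UNIV :: 'u::infinite set|" "|B| \<le>o |UNIV :: 'u set|"
  shows "|A \<union> B| \<le>o |UNIV :: 'u set|"
  by (rule card_of_Un_ordLeq_infinite_Field[OF _ assms card_of_Card_order])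
     (simp add: Field_card_of infinite_type)

lemma small_strict_bound:
  fixes S :: "'u::infinite ordinal set"
  assumes "|S| \<le>o |UNIV :: 'u set|"
  obtains \<gamma> where "\<And>\<beta>. \<beta> \<in> S \<Longrightarrow> \<beta> < \<gamma>"
proof -
  define D where "D = S \<union> (\<Union>\<beta>\<in>S. {..<\<beta>})"
  have U: "|\<Union>\<beta>\<in>S. {..<\<beta>}| \<le>o |UNIV :: 'u set|"
    using infinite_type assms card_lessThan_ordinal
    by (intro card_of_UNION_ordLeq_infinite) auto
  have "|D| \<le>o |UNIV :: 'u set|"
    unfolding D_def by (rule small_Un[OF assms U])
  then obtain f :: "'u ordinal \<Rightarrow> 'u" where f: "inj_on f D"
    unfolding card_of_ordLeq[symmetric] by blast
  define r where "r = dir_image (ord_rel D) f"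
  have r: "ord_rel D =o r"
    unfolding r_def by (rule dir_image_ordIso[OF Well_order_ord_rel]) (simp add: f)
  then have rr: "rep_ordinal (abs_ordinal r) =o r"
    using ordIso_well_orderD(2) abs_ordinal_iso by blast
  have "\<beta> < abs_ordinal r" if "\<beta> \<in> S" for \<beta>
  proof -
    have b: "\<beta> \<in> D" and *: "\<And>\<gamma>. \<gamma> < \<beta> \<Longrightarrow> \<gamma> \<in> D"
      using that by (auto simp: D_def)
    have "ord_rel {..<\<beta>} <o ord_rel D"
      using underS_Restr_ordLess[of "ord_rel D" \<beta>, OF Well_order_ord_rel] b Restr_underS_ord_rel[OF b *] by auto
    then show ?thesis
      unfolding less_ordinal.rep_eq
      using ordinal_segment[of \<beta>] r rr
      by (meson ordIso_ordLess_trans ordLess_ordIso_trans ordIso_symmetric)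
  qed
  then show thesis using that by blast
qed

lemma less_osucc: "\<alpha> < osucc (\<alpha> :: 'u::infinite ordinal)"
proof -
  have "finite {\<alpha>}" by simp
  then have "|{\<alpha>}| \<le>o |UNIV :: 'u set|"
    using infinite_type by (meson card_of_ordLeq_infinite card_of_Well_order ordLeq_total)
  then obtain \<gamma> where "\<alpha> < \<gamma>"
    using small_strict_bound by (metis insertI1)
  then show ?thesis unfolding osucc_def by (rule LeastI)
qed

lemma osucc_le_iff: "osucc \<alpha> \<le> \<beta> \<longleftrightarrow> (\<alpha> :: 'u::infinite ordinal) < \<beta>"
  using less_osucc[of \<alpha>] by (auto simp: osucc_def intro: Least_le)

lemma modalities_derives:
  "\<phi> \<turnstile> \<psi> \<Longrightarrow> modalities \<phi> \<subseteq> {..<\<gamma>} \<Longrightarrow> modalities \<psi> \<subseteq> {..<\<gamma>}"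
  by (induction rule: rc_derives.induct) auto

lemma card_worms_bounded:
  "|{A \<in> worms. modalities A \<subseteq> {..<\<gamma> :: 'u::infinite ordinal}}| \<le>o |UNIV :: 'u set|"
proof -
  define W where "W n = ((\<lambda>V. insert Top (case_prod Dia ` ({..<\<gamma>} \<times> V))) ^^ n) {}" for n :: nat
  have W: "|W n| \<le>o |UNIV :: 'u set|" for n
  proof (induction n)
    case 0
    then show ?case by (simp add: W_def card_of_empty)
  next
    case (Suc n)
    have "|{..<\<gamma>} \<times> W n| \<le>o |UNIV :: 'u set|"
      using card_lessThan_ordinal Suc infinite_type
      by (intro card_of_Sigma_ordLeq_infinite) auto
    then have 1: "|case_prod Dia ` ({..<\<gamma>} \<times> W n)| \<le>o |UNIV :: 'u set|"
      using card_of_image ordLeq_transitive by blast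
    have "|{Top :: 'u formula}| \<le>o |UNIV :: 'u set|"
      using infinite_type
      by (meson card_of_Well_order card_of_ordLeq_infinite finite.emptyI finite.insertI ordLeq_total)
    from this 1 have "|{Top} \<union> case_prod Dia ` ({..<\<gamma>} \<times> W n)| \<le>o |UNIV :: 'u set|"
      by (rule small_Un)
    then show ?case by (simp add: W_def)
  qed
  have "\<exists>n. A \<in> W n" if "A \<in> worms" "modalities A \<subseteq> {..<\<gamma>}" for A
    using that
  proof (induction rule: worms.induct)
    case Top
    have "Top \<in> W (Suc 0)" by (simp add: W_def)
    then show ?case ..
  next
    case (Dia A \<alpha>)
    then obtain n where "A \<in> W n" by auto
    with Dia have "Dia \<alpha> A \<in> W (Suc n)" by (auto simp: W_def)
    then show ?case ..
  qed
  then have "{A \<in> worms. modalities A \<subseteq> {..<\<gamma>}} \<subseteq> (\<Union>n. W n)"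
    by blast
  then have "|{A \<in> worms. modalities A \<subseteq> {..<\<gamma>}}| \<le>o |\<Union>n. W n|"
    by (rule card_of_mono1)
  also have "|\<Union>n. W n| \<le>o |UNIV :: 'u set|"
    using W infinite_type infinite_iff_card_of_nat
    by (intro card_of_UNION_ordLeq_infinite) auto
  finally show ?thesis .
qed

lemma card_below_worm:
  fixes A :: "'u::infinite formula"
  shows "|{B \<in> worms. worm_less \<xi> B A}| \<le>o |UNIV :: 'u set|"
proof -
  have "finite (modalities A)"
    by (induction A) auto
  then have "|modalities A| \<le>o |UNIV :: 'u set|"
    using infinite_type by (meson card_of_Well_order card_of_ordLeq_infinite ordLeq_total)
  then obtain \<gamma> where "\<And>\<beta>. \<beta> \<in> modalities A \<Longrightarrow> \<beta> < \<gamma>"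
    by (rule small_strict_bound) blast
  then have "modalities A \<subseteq> {..<\<gamma>}" by auto
  then have "{B \<in> worms. worm_less \<xi> B A} \<subseteq> {B \<in> worms. modalities B \<subseteq> {..<\<gamma>}}"
    unfolding worm_less_def using modalities_derives by fastforce
  then show ?thesis
    using card_worms_bounded card_of_mono1 ordLeq_transitive by blast
qed

lemma bdd_above_below_worm:
  fixes A :: "'u::infinite formula" and f :: "'u formula \<Rightarrow> 'u ordinal"
  assumes "X \<subseteq> {B \<in> worms. worm_less \<xi> B A}"
  shows "bdd_above (f ` X)"
proof -
  have "|f ` X| \<le>o |X|" by (rule card_of_image)
  also have "|X| \<le>o |{B \<in> worms. worm_less \<xi> B A}|" by (rule card_of_mono1[OF assms])
  also have "|{B \<in> worms. worm_less \<xi> B A}| \<le>o |UNIV :: 'u set|" by (rule card_below_worm)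
  finally obtain \<gamma> where "\<And>\<beta>. \<beta> \<in> f ` X \<Longrightarrow> \<beta> < \<gamma>"
    by (rule small_strict_bound) blast
  then show ?thesis
    by (meson bdd_aboveI less_imp_le)
qed

end

theory Submission
  imports Defs
begin

text \<open>
  Replacing every subformula with outer modality below \<open>\<xi>\<close> by \<open>\<top>\<close> preserves derivability, because it
  does so for each axiom and rule.  Hence \<open>B <\<^sub>\<xi> A\<close> implies \<open>h\<^sub>\<xi> B <\<^sub>\<xi> h\<^sub>\<xi> A\<close>, while \<open>C <\<^sub>\<xi> h\<^sub>\<xi> A\<close> implies
  \<open>C <\<^sub>\<xi> A\<close> since \<open>A \<turnstile> h\<^sub>\<xi> A\<close>.  So the graph of \<open>h\<^sub>\<xi>\<close> is a bisimulation between the worms and the worms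
  with modalities at least \<open>\<xi>\<close>, both ordered by \<open><\<^sub>\<xi>\<close>, and bisimilar elements have the same rank.

  Bisimilar elements are also accessible simultaneously.  On inaccessible elements every function
  defined by \<open>wfrec\<close> takes the single junk value \<open>THE y. False\<close>, so the argument does not depend on
  the well-foundedness of \<open><\<^sub>\<xi>\<close>.
\<close>

text \<open>A value enters the graph at \<open>x\<close> only after values at all
  \<open>R\<close>-predecessors of \<open>x\<close> have done so.\<close>

lemma wfrec_rel_imp_acc: "wfrec_rel R F x y \<Longrightarrow> x \<in> Wellfounded.acc R"
  by (induction rule: wfrec_rel.induct) (auto intro: accI)

lemma wfrec_not_acc:
  assumes "x \<notin> Wellfounded.acc R"
  shows "wfrec R F x = (THE y. False)"
proof -
  have "\<not> wfrec_rel R (\<lambda>f x. F (cut f R x) x) x y" for y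
    using assms wfrec_rel_imp_acc[of R "\<lambda>f x. F (cut f R x) x"] by blast
  then have "wfrec_rel R (\<lambda>f x. F (cut f R x) x) x = (\<lambda>y. False)"
    by blast
  then show ?thesis
    by (simp add: wfrec_def)
qed

lemma wfrec_rel_ex1:
  assumes "adm_wf R F" "x \<in> Wellfounded.acc R"
  shows "\<exists>!y. wfrec_rel R F x y"
  using assms(2)
proof (induction rule: acc.induct)
  case (accI x)
  define f where "f z = (THE y. wfrec_rel R F z y)" for z
  have f: "wfrec_rel R F z y \<longleftrightarrow> y = f z" if "(z, x) \<in> R" for z y
    unfolding f_def using accI.IH[OF that] by (rule theI_unique)
  \<comment> \<open>Any function taking graph values below \<open>x\<close> agrees there with
    \<open>f\<close>, so admissibility forces the value \<open>F f x\<close>.\<close>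
  show ?case
    by (subst wfrec_rel.simps) (use f assms(1) in \<open>auto simp: adm_wf_def\<close>)
qed

lemma wfrec_acc:
  assumes "x \<in> Wellfounded.acc R"
  shows "wfrec R F x = F (cut (wfrec R F) R x) x"
  unfolding wfrec_def
  by (intro the1_equality wfrec_rel_ex1[OF adm_lemma] assms wfrec_rel.wfrecI allI impI
      theI'[OF wfrec_rel_ex1[OF adm_lemma]] acc_downward[OF assms])

text \<open>Accessibility passes along \<open>Q\<close> by induction on \<open>x\<close>: every step
  down from \<open>y\<close> lifts to a step down from \<open>x\<close>.\<close>

lemma acc_bisim:
  assumes "x \<in> Wellfounded.acc R" "Q x y"
    and "\<And>x y y'. Q x y \<Longrightarrow> (y', y) \<in> S \<Longrightarrow> \<exists>x'. (x', x) \<in> R \<and> Q x' y'"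
  shows "y \<in> Wellfounded.acc S"
  using assms(1,2)
proof (induction arbitrary: y rule: acc.induct)
  case (accI x)
  show ?case
  proof (rule acc.intros)
    fix y' assume "(y', y) \<in> S"
    then obtain x' where "(x', x) \<in> R" "Q x' y'"
      using assms(3)[OF accI.prems] by blast
    then show "y' \<in> Wellfounded.acc S"
      by (rule accI.IH)
  qed
qed

text \<open>Through \<open>\<Phi>\<close> both recursions see only the set of values at
  predecessors, and by induction these sets coincide for related elements.\<close>

lemma wfrec_bisim:
  assumes "Q x y"
    and sim: "\<And>x y x'. Q x y \<Longrightarrow> (x', x) \<in> R \<Longrightarrow> \<exists>y'. (y', y) \<in> S \<and> Q x' y'"
    and sim_conv: "\<And>x y y'. Q x y \<Longrightarrow> (y', y) \<in> S \<Longrightarrow> \<exists>x'. (x', x) \<in> R \<and> Q x' y'"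
    and F: "\<And>f x y. Q x y \<Longrightarrow> F f x = \<Phi> (f ` {x'. (x', x) \<in> R})"
    and G: "\<And>g x y. Q x y \<Longrightarrow> G g y = \<Phi> (g ` {y'. (y', y) \<in> S})"
  shows "wfrec R F x = wfrec S G y"
proof -
  have acc_iff: "x \<in> Wellfounded.acc R \<longleftrightarrow> y \<in> Wellfounded.acc S" if "Q x y" for x y
  proof
    assume "x \<in> Wellfounded.acc R"
    then show "y \<in> Wellfounded.acc S"
      using that by (rule acc_bisim) (rule sim_conv)
  next
    assume "y \<in> Wellfounded.acc S"
    then show "x \<in> Wellfounded.acc R"
      using that by (rule acc_bisim[where Q = "\<lambda>y x. Q x y"]) (rule sim)
  qed
  show ?thesis
  proof (cases "x \<in> Wellfounded.acc R")
    case True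
    then show ?thesis
      using \<open>Q x y\<close>
    proof (induction arbitrary: y rule: acc.induct)
      case (accI x)
      have acc: "x \<in> Wellfounded.acc R" "y \<in> Wellfounded.acc S"
        using acc.intros[OF accI.hyps] acc_iff[OF \<open>Q x y\<close>] by auto
      have IH: "wfrec R F x' = wfrec S G y'" if "(x', x) \<in> R" "Q x' y'" for x' y'
        using accI.IH that by blast
      have "wfrec R F x = \<Phi> (wfrec R F ` {x'. (x', x) \<in> R})"
        by (subst wfrec_acc[OF acc(1)]) (auto simp: F[OF \<open>Q x y\<close>] cut_apply cong: image_cong_simp)
      also have "wfrec R F ` {x'. (x', x) \<in> R} = wfrec S G ` {y'. (y', y) \<in> S}"
      proof (intro equalityI subsetI; elim imageE CollectE; hypsubst)
        fix x' assume "(x', x) \<in> R"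
        then show "wfrec R F x' \<in> wfrec S G ` {y'. (y', y) \<in> S}"
          using sim[OF \<open>Q x y\<close>] IH by blast
      next
        fix y' assume "(y', y) \<in> S"
        then show "wfrec S G y' \<in> wfrec R F ` {x'. (x', x) \<in> R}"
          using sim_conv[OF \<open>Q x y\<close>] IH by (metis imageI mem_Collect_eq)
      qed
      also have "\<Phi> \<dots> = wfrec S G y"
        by (subst wfrec_acc[OF acc(2)]) (auto simp: G[OF \<open>Q x y\<close>] cut_apply cong: image_cong_simp)
      finally show ?case .
    qed
  next
    case False
    then show ?thesis
      using acc_iff[OF \<open>Q x y\<close>] by (simp add: wfrec_not_acc)
  qed
qed

text \<open>On conjunctions \<open>head\<close> is unspecified, so derivations need an extension to all formulas.\<close>

primrec formula_head :: "'u ordinal \<Rightarrow> 'u formula \<Rightarrow> 'u formula" where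
  "formula_head \<xi> Top = Top"
| "formula_head \<xi> (Conj \<phi> \<psi>) = Conj (formula_head \<xi> \<phi>) (formula_head \<xi> \<psi>)"
| "formula_head \<xi> (Dia \<zeta> \<phi>) = (if \<xi> \<le> \<zeta> then Dia \<zeta> (formula_head \<xi> \<phi>) else Top)"

lemma formula_head_derives:
  "\<phi> \<turnstile> \<psi> \<Longrightarrow> formula_head \<xi> \<phi> \<turnstile> formula_head \<xi> \<psi>"
proof (induction rule: rc_derives.induct)
  case (polytrans \<alpha> \<beta> \<phi> \<psi>)
  \<comment> \<open>If \<alpha> < \<xi> \<le> \<beta>, truncation turns
    \<open>Dia \<alpha> \<psi>\<close> into \<open>Top\<close>, and the result is no longer an
    instance of the axiom.\<close>
  have "Conj (Dia \<beta> \<phi>') Top \<turnstile> Dia \<beta> (Conj \<phi>' Top)" for \<phi>'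
    by (rule rc_derives.cut[OF rc_derives.conjE1
          rc_derives.nec[OF rc_derives.conjI[OF rc_derives.refl rc_derives.top]]])
  then show ?case
    using polytrans by (auto intro: rc_derives.polytrans rc_derives.top)
next
  case (cut \<phi> \<psi> \<chi>)
  then show ?case
    by (blast intro: rc_derives.cut)
qed (auto intro: rc_derives.refl rc_derives.top rc_derives.conjE1 rc_derives.conjE2
    rc_derives.trans4 rc_derives.mono rc_derives.conjI rc_derives.nec)

lemma formula_head_worm: "A \<in> worms \<Longrightarrow> formula_head \<xi> A = head \<xi> A"
  by (induction rule: worms.induct) auto

lemma derives_head: "A \<in> worms \<Longrightarrow> A \<turnstile> head \<xi> A"
  by (induction rule: worms.induct) (auto intro: rc_derives.top rc_derives.nec)

lemma head_in_worms_ge: "A \<in> worms \<Longrightarrow> head \<xi> A \<in> worms_ge \<xi>"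
  by (induction rule: worms.induct) (auto simp: worms_ge_def intro: worms.intros)

lemma head_worms_ge:
  assumes "A \<in> worms_ge \<xi>"
  shows "head \<xi> A = A"
proof -
  have "A \<in> worms" "\<forall>\<zeta>\<in>modalities A. \<xi> \<le> \<zeta>"
    using assms by (auto simp: worms_ge_def)
  then show ?thesis
    by (induction rule: worms.induct) auto
qed

text \<open>The outer modality of \<open>Dia \<xi> B\<close> is not below \<xi>, so it survives
  truncation.\<close>

lemma worm_less_head_head:
  assumes "A \<in> worms" "B \<in> worms" "worm_less \<xi> B A"
  shows "worm_less \<xi> (head \<xi> B) (head \<xi> A)"
  using formula_head_derives[of A "Dia \<xi> B" \<xi>] assms
  by (simp add: worm_less_def formula_head_worm)

lemma worm_less_of_head:
  assumes "A \<in> worms" "worm_less \<xi> B (head \<xi> A)"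
  shows "worm_less \<xi> B A"
  using assms derives_head rc_derives.cut unfolding worm_less_def by blast

lemma o_rank_eq_o_rank_ge_head:
  assumes "A \<in> worms"
  shows "o_rank \<xi> A = o_rank_ge \<xi> (head \<xi> A)"
  unfolding o_rank_def o_rank_ge_def
proof (rule wfrec_bisim[where Q = "\<lambda>A C. A \<in> worms \<and> C = head \<xi> A" and \<Phi> = "\<lambda>X. SUP \<alpha>\<in>X. osucc \<alpha>"])
  fix A C B :: "'a formula"
  assume "A \<in> worms \<and> C = head \<xi> A" "(B, A) \<in> {(B, A). B \<in> worms \<and> A \<in> worms \<and> worm_less \<xi> B A}"
  then show "\<exists>D. (D, C) \<in> {(B, A). B \<in> worms_ge \<xi> \<and> A \<in> worms_ge \<xi> \<and> worm_less \<xi> B A} \<and>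
      B \<in> worms \<and> D = head \<xi> B"
    by (auto simp: head_in_worms_ge worm_less_head_head)
next
  fix A C D :: "'a formula"
  assume "A \<in> worms \<and> C = head \<xi> A"
    "(D, C) \<in> {(B, A). B \<in> worms_ge \<xi> \<and> A \<in> worms_ge \<xi> \<and> worm_less \<xi> B A}"
  then show "\<exists>B. (B, A) \<in> {(B, A). B \<in> worms \<and> A \<in> worms \<and> worm_less \<xi> B A} \<and>
      B \<in> worms \<and> D = head \<xi> B"
    \<comment> \<open>Being in \<open>worms_ge \<xi>\<close>, \<open>D\<close> is its own head and
      serves as the witness \<open>B\<close>.\<close>
    by (intro exI[of _ D]) (auto simp: head_worms_ge worm_less_of_head, auto simp: worms_ge_def)
qed (use assms in \<open>auto simp: image_image head_in_worms_ge\<close>)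

theorem lemma4p11:
  fixes A :: "'u::infinite formula" and \<xi> :: "'u ordinal"
  assumes "A \<in> worms"
  shows "o_rank \<xi> A = o_rank \<xi> (head \<xi> A) \<and>
         o_rank \<xi> (head \<xi> A) = o_rank_ge \<xi> (head \<xi> A)"
proof -
  have "head \<xi> A \<in> worms_ge \<xi>"
    using assms by (rule head_in_worms_ge)
  then have "o_rank \<xi> (head \<xi> A) = o_rank_ge \<xi> (head \<xi> A)"
    using o_rank_eq_o_rank_ge_head[of "head \<xi> A" \<xi>] by (simp add: head_worms_ge worms_ge_def)
  then show ?thesis
    using o_rank_eq_o_rank_ge_head[OF assms] by simp
qed

end
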